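(* Let $\mathbf{Z}$ be a nonempty finite measurable space in which all singletons are measurable, let $N\ge1$ be an integer, and suppose $K:=|\mathbf{Z}|\le N$. Let $n_1,\dots,n_K$ be any balanced split of $N$ into $K$ parts, i.e., integers satisfying $$n_k\in\{\lfloor N/K\rfloor,\lceil N/K\rceil\}\ \text{ for } k=1,\dots,K,\qquad \sum_{k=1}^K n_k=N,$$ and put $$C:=\frac{N^N}{N!}\prod_{k=1}^K\frac{n_k!}{n_k^{n_k}}.$$ Then for any function $F:\mathbf{Z}^N\to[0,\infty)$ we have $$\mathbb{E}^{\mathrm{X}}(F)\le C\,\mathbb{E}^{\mathrm{R}}(F).$$ The factor $C$ is tight (it cannot be replaced by any smaller constant); moreover, there exists an event $A\subseteq\mathbf{Z}^N$ such that $$\mathbb{P}^{\mathrm{R}}(A)=1/C\le1=\mathbb{P}^{\mathrm{X}}(A).$$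
   Context: Since $\mathbf{Z}$ is finite with measurable singletons, all subsets of $\mathbf{Z}^N$ and all functions on $\mathbf{Z}^N$ are measurable. A probability measure $R$ on $\mathbf{Z}^N$ is exchangeable if it is invariant under swapping any pair of coordinates (equivalently, under all permutations of the $N$ coordinates). $\mathfrak{P}(\mathbf{Z})$ is the set of all probability measures on $\mathbf{Z}$, and $Q^N$ is the $N$-fold product of $Q\in\mathfrak{P}(\mathbf{Z})$. For $F:\mathbf{Z}^N\to[0,\infty)$ define $$\mathbb{E}^{\mathrm{X}}(F):=\sup_R\int F\,\mathrm{d}R,\qquad \mathbb{E}^{\mathrm{R}}(F):=\sup_{Q\in\mathfrak{P}(\mathbf{Z})}\int F\,\mathrm{d}Q^N,$$ where $R$ ranges over the exchangeable probability measures on $\mathbf{Z}^N$. For $A\subseteq\mathbf{Z}^N$ define $$\mathbb{P}^{\mathrm{X}}(A):=\sup_R R(A),\qquad \mathbb{P}^{\mathrm{R}}(A):=\sup_{Q\in\mathfrak{P}(\mathbf{Z})}Q^N(A),$$ with $R$ again ranging over the exchangeable probability measures on $\mathbf{Z}^N$. *)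

theory Defs
  imports "HOL-Probability.Probability"
begin

text \<open>
  A measurable space is given by a value \<open>Z\<close> of type \<open>'z measure\<close> of which only \<open>space Z\<close> and
  \<open>sets Z\<close> are used. The probability measures on \<open>Z\<close> are the elements of
  \<open>space (prob_algebra Z)\<close>, that is, the \<open>Q\<close> with \<open>prob_space Q\<close> and \<open>sets Q = sets Z\<close>.
  The coordinates of the power space are numbered from \<open>0\<close> to \<open>N - 1\<close>.
\<close>

definition power_space :: "'z measure \<Rightarrow> nat \<Rightarrow> (nat \<Rightarrow> 'z) measure" where
  "power_space Z N = PiM {..<N} (\<lambda>_. Z)"

definition exchangeable :: "'z measure \<Rightarrow> nat \<Rightarrow> (nat \<Rightarrow> 'z) measure \<Rightarrow> bool" where
  "exchangeable Z N R \<longleftrightarrow>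
     R \<in> space (prob_algebra (power_space Z N)) \<and>
     (\<forall>i<N. \<forall>j<N. distr R (power_space Z N) (\<lambda>\<omega>. \<omega> \<circ> Transposition.transpose i j) = R)"

text \<open>
  The suprema below are taken in the reals. If \<open>space Z\<close> is finite and nonempty and the singletons
  of \<open>Z\<close> are measurable, they range over nonempty bounded sets, and every function on the power
  space is integrable with respect to all the measures involved.
\<close>

definition exch_expectation :: "'z measure \<Rightarrow> nat \<Rightarrow> ((nat \<Rightarrow> 'z) \<Rightarrow> real) \<Rightarrow> real" where
  "exch_expectation Z N F = (SUP R\<in>{R. exchangeable Z N R}. \<integral>\<omega>. F \<omega> \<partial>R)"

definition rand_expectation :: "'z measure \<Rightarrow> nat \<Rightarrow> ((nat \<Rightarrow> 'z) \<Rightarrow> real) \<Rightarrow> real" where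
  "rand_expectation Z N F = (SUP Q\<in>space (prob_algebra Z). \<integral>\<omega>. F \<omega> \<partial>(power_space Q N))"

definition exch_prob :: "'z measure \<Rightarrow> nat \<Rightarrow> (nat \<Rightarrow> 'z) set \<Rightarrow> real" where
  "exch_prob Z N A = (SUP R\<in>{R. exchangeable Z N R}. measure R A)"

definition rand_prob :: "'z measure \<Rightarrow> nat \<Rightarrow> (nat \<Rightarrow> 'z) set \<Rightarrow> real" where
  "rand_prob Z N A = (SUP Q\<in>space (prob_algebra Z). measure (power_space Q N) A)"

end

theory Submission
  imports Defs "HOL-Combinatorics.Multiset_Permutations"
begin

text \<open>
  The type of a word \<open>\<omega> \<in> Z\<^sup>N\<close> is the multiset of its letters. An exchangeable measure is
  constant on each class of words of a common type \<open>T\<close>, while the power \<open>Q\<^sup>N\<close> of the empirical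
  distribution \<open>Q = T / N\<close> gives that class the mass \<open>1 / C\<^sub>T\<close>, where
  \<open>C\<^sub>T = N\<^sup>N / N! \<cdot> \<Prod>\<^sub>z g(T z)\<close> and \<open>g(t) = t! / t\<^sup>t\<close>. Hence the integral is bounded class by class
  with the constant \<open>max\<^sub>T C\<^sub>T\<close>. Since \<open>g(t + 1) / g(t) = (t / (t + 1))\<^sup>t\<close> is decreasing, \<open>g\<close> is
  log-concave and balanced types attain the maximum. The bound is attained by the class of words
  of a balanced type: the uniform measure on it is exchangeable, and by Gibbs' inequality
  no \<open>Q\<^sup>N\<close> gives it more mass than the empirical distribution does.
\<close>

section \<open>Balanced splits\<close>

text \<open>The function \<open>g\<close> of the overview. Since \<open>0 ^ 0 = 1\<close>, its value
  at 0 is 1, so letters that do not occur leave products unchanged.\<close>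

definition self_power_ratio :: "nat \<Rightarrow> real" where
  "self_power_ratio t = fact t / real t ^ t"

definition step_ratio :: "nat \<Rightarrow> real" where
  "step_ratio t = (real t / real (Suc t)) ^ t"

lemma self_power_ratio_pos: "self_power_ratio t > 0"
  by (cases "t = 0") (simp_all add: self_power_ratio_def)

lemma step_ratio_pos: "step_ratio t > 0"
  by (cases "t = 0") (simp_all add: step_ratio_def)

lemma self_power_ratio_Suc: "self_power_ratio (Suc t) = self_power_ratio t * step_ratio t"
proof (cases "t = 0")
  case False
  then show ?thesis
    by (simp add: self_power_ratio_def step_ratio_def power_divide divide_simps)
qed (simp add: self_power_ratio_def step_ratio_def)

text \<open>For \<open>t > 0\<close>, \<open>step_ratio t\<close> is the reciprocal of
  \<open>(1 + 1 / t) ^ t\<close>, whose classical monotonicity follows from Bernoulli's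
  inequality.\<close>

lemma step_ratio_Suc_le: "step_ratio (Suc t) \<le> step_ratio t"
proof (cases "t = 0")
  case True
  then show ?thesis by (simp add: step_ratio_def)
next
  case False
  define x where "x = real t"
  have x: "x > 0"
    using False by (simp add: x_def)
  \<comment> \<open>\<open>u\<close> is the quotient of \<open>x / (x + 1)\<close> by
    \<open>(x + 1) / (x + 2)\<close>, the bases of the two powers to be compared; it lies slightly
    below 1.\<close>
  define u where "u = x * (x + 2) / (x + 1) ^ 2"
  have u: "u = 1 + (- 1 / (x + 1) ^ 2)"
    using x by (simp add: u_def divide_simps) (simp add: power2_eq_square algebra_simps)
  have "1 + real (Suc t) * (- 1 / (x + 1) ^ 2) \<le> u ^ Suc t"
    unfolding u
  proof (rule Bernoulli_inequality)
    have "1 \<le> (x + 1) ^ 2"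
      using x by (intro one_le_power) simp
    then show "- 1 \<le> - 1 / (x + 1) ^ 2"
      by (simp add: divide_simps)
  qed
  moreover have "1 + y * (- 1 / y ^ 2) = (y - 1) / y" if "y > 0" for y :: real
    using that by (simp add: field_simps power2_eq_square)
  \<comment> \<open>For the exponent \<open>t + 1\<close> the Bernoulli bound collapses to
    \<open>x / (x + 1)\<close>, the one extra factor that is cancelled at the end.\<close>
  from this[of "real (Suc t)"] have "1 + real (Suc t) * (- 1 / (x + 1) ^ 2) = x / (x + 1)"
    by (simp add: x_def add_ac)
  ultimately have "x / (x + 1) \<le> u ^ Suc t"
    by simp
  then have "((x + 1) / (x + 2)) ^ Suc t * (x / (x + 1)) \<le> ((x + 1) / (x + 2)) ^ Suc t * u ^ Suc t"
    using x by (intro mult_left_mono) auto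
  also have "\<dots> = (x / (x + 1)) ^ t * (x / (x + 1))"
  proof -
    have "a / b * (c * b / a ^ 2) = c / a" if "a > 0" "b > 0" for a b c :: real
      using that by (simp add: field_simps power2_eq_square)
    from this[of "x + 1" "x + 2" x] have "(x + 1) / (x + 2) * u = x / (x + 1)"
      using x by (simp add: u_def)
    then show ?thesis
      by (metis power_Suc2 power_mult_distrib)
  qed
  finally have "((x + 1) / (x + 2)) ^ Suc t \<le> (x / (x + 1)) ^ t"
    by (rule mult_right_le_imp_le) (use x in simp)
  then show ?thesis
    by (simp add: step_ratio_def x_def add_ac)
qed

lemma step_ratio_antimono: "s \<le> t \<Longrightarrow> step_ratio t \<le> step_ratio s"
  by (rule lift_Suc_antimono_le[of step_ratio]) (rule step_ratio_Suc_le)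

text \<open>The supporting line at \<open>m\<close> of the concave function \<open>ln \<circ> self_power_ratio\<close>.\<close>

lemma self_power_ratio_support:
  "self_power_ratio t * step_ratio m ^ m \<le> self_power_ratio m * step_ratio m ^ t"
proof (cases "m \<le> t")
  case True
  then show ?thesis
  proof (induction t rule: dec_induct)
    case (step t)
    have "self_power_ratio (Suc t) * step_ratio m ^ m
        = self_power_ratio t * step_ratio m ^ m * step_ratio t"
      by (simp add: self_power_ratio_Suc)
    also have "\<dots> \<le> self_power_ratio m * step_ratio m ^ t * step_ratio m"
      by (intro mult_mono step step_ratio_antimono)
        (use step self_power_ratio_pos step_ratio_pos in \<open>auto intro: less_imp_le\<close>)
    finally show ?case by (simp add: mult_ac)
  qed simp
next
  case False
  then have "t \<le> m" by simp
  then show ?thesis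
  proof (induction t rule: inc_induct)
    case (step t)
    \<comment> \<open>The factor \<open>step_ratio m\<close> leads from \<open>t\<close> to
      \<open>Suc t\<close> and is cancelled at the end; left of \<open>m\<close> it is at most
      \<open>step_ratio t\<close>.\<close>
    have "self_power_ratio t * step_ratio m ^ m * step_ratio m
        \<le> self_power_ratio t * step_ratio m ^ m * step_ratio t"
      by (intro mult_left_mono step_ratio_antimono)
        (use step self_power_ratio_pos step_ratio_pos in \<open>auto intro: less_imp_le\<close>)
    also have "\<dots> = self_power_ratio (Suc t) * step_ratio m ^ m"
      by (simp add: self_power_ratio_Suc)
    also have "\<dots> \<le> self_power_ratio m * step_ratio m ^ t * step_ratio m"
      using step.IH by (simp add: mult_ac)
    finally show ?case
      using step_ratio_pos[of m] by simp
  qed simp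
qed

text \<open>On the logarithmic scale the supporting line is the chord from \<open>m\<close> to
  \<open>m + 1\<close>, so it meets the graph at both ends.\<close>

lemma self_power_ratio_support_eq:
  assumes "t = m \<or> t = Suc m"
  shows "self_power_ratio t * step_ratio m ^ m = self_power_ratio m * step_ratio m ^ t"
  using assms by (auto simp: self_power_ratio_Suc)

text \<open>Each factor is bounded by the supporting line at \<open>m\<close>. The product of these
  bounds depends on the exponents only through their sum, and balanced exponents attain it factor by
  factor.\<close>

lemma prod_self_power_ratio_le_balanced:
  assumes "finite S" "(\<Sum>z\<in>S. t z) = (\<Sum>z\<in>S. b z)"
    and bal: "\<And>z. z \<in> S \<Longrightarrow> b z = m \<or> b z = Suc m"
  shows "(\<Prod>z\<in>S. self_power_ratio (t z)) \<le> (\<Prod>z\<in>S. self_power_ratio (b z))"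
proof -
  let ?c = "\<Prod>z\<in>S. step_ratio m ^ m"
  have "(\<Prod>z\<in>S. self_power_ratio (t z)) * ?c
      = (\<Prod>z\<in>S. self_power_ratio (t z) * step_ratio m ^ m)"
    by (rule prod.distrib[symmetric])
  also have "\<dots> \<le> (\<Prod>z\<in>S. self_power_ratio m * step_ratio m ^ t z)"
    by (intro prod_mono conjI self_power_ratio_support mult_nonneg_nonneg zero_le_power)
      (auto intro: less_imp_le self_power_ratio_pos step_ratio_pos)
  also have "\<dots> = (\<Prod>z\<in>S. self_power_ratio m * step_ratio m ^ b z)"
    using assms(2) by (simp add: prod.distrib flip: power_sum)
  also have "\<dots> = (\<Prod>z\<in>S. self_power_ratio (b z) * step_ratio m ^ m)"
    by (intro prod.cong refl self_power_ratio_support_eq[symmetric] bal)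
  also have "\<dots> = (\<Prod>z\<in>S. self_power_ratio (b z)) * ?c"
    by (rule prod.distrib)
  finally show ?thesis
    using step_ratio_pos[of m] by (simp add: prod_pos)
qed

text \<open>Floor and ceiling differ by at most 1, so the parts lie among two consecutive integers
  and \<open>N div K\<close> can serve as the support point \<open>m\<close>.\<close>

lemma balanced_split_cases:
  fixes t N K :: nat
  assumes "int t \<in> {\<lfloor>real N / real K\<rfloor>, \<lceil>real N / real K\<rceil>}"
  shows "t = N div K \<or> t = Suc (N div K)"
proof -
  have f: "\<lfloor>real N / real K\<rfloor> = int (N div K)"
    by (simp add: floor_divide_of_nat_eq)
  moreover have "\<lceil>real N / real K\<rceil> = \<lfloor>real N / real K\<rfloor> \<or> \<lceil>real N / real K\<rceil> = \<lfloor>real N / real K\<rfloor> + 1"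
    by linarith
  ultimately show ?thesis
    using assms by auto
qed

section \<open>Gibbs' inequality\<close>

text \<open>Applying \<open>x \<le> exp (x - 1)\<close> to the ratio \<open>x\<close> of
  \<open>q z\<close> to the empirical frequency leaves exponential corrections whose exponents sum
  to \<open>N - N = 0\<close>.\<close>

lemma prod_power_le_empirical:
  fixes q :: "'a \<Rightarrow> real" and t :: "'a \<Rightarrow> nat"
  assumes "\<And>z. z \<in> S \<Longrightarrow> 0 \<le> q z" "(\<Sum>z\<in>S. q z) = 1" "(\<Sum>z\<in>S. t z) = N" "N > 0"
  shows "(\<Prod>z\<in>S. q z ^ t z) \<le> (\<Prod>z\<in>S. (real (t z) / real N) ^ t z)"
proof -
  \<comment> \<open>A sum over an infinite set is 0 by default, so the value 1 forces
    finiteness.\<close>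
  have fin: "finite S"
    using assms(2) by (metis sum.infinite zero_neq_one)
  have "q z ^ t z \<le> (real (t z) / real N) ^ t z * exp (q z * real N - real (t z))"
    if z: "z \<in> S" for z
  proof (cases "t z = 0")
    case True
    then show ?thesis using assms(1)[OF z] by simp
  next
    case False
    define x where "x = q z * real N / real (t z)"
    have q: "q z = real (t z) / real N * x"
      using False \<open>N > 0\<close> by (simp add: x_def)
    have "x \<le> exp (x - 1)"
      using exp_ge_add_one_self[of "x - 1"] by simp
    then have "x ^ t z \<le> exp (x - 1) ^ t z"
      using assms(1)[OF z] by (intro power_mono) (auto simp: x_def)
    also have "\<dots> = exp (q z * real N - real (t z))"
      using False by (simp add: x_def field_simps flip: exp_of_nat_mult)
    finally show ?thesis
      using False by (subst (1) q, unfold power_mult_distrib) (intro mult_left_mono, auto)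
  qed
  then have "(\<Prod>z\<in>S. q z ^ t z)
      \<le> (\<Prod>z\<in>S. (real (t z) / real N) ^ t z * exp (q z * real N - real (t z)))"
    by (intro prod_mono) (auto simp: assms(1))
  also have "\<dots> = (\<Prod>z\<in>S. (real (t z) / real N) ^ t z) * exp (\<Sum>z\<in>S. q z * real N - real (t z))"
    using fin by (simp add: prod.distrib exp_sum)
  also have "(\<Sum>z\<in>S. q z * real N - real (t z)) = 0"
    using assms(2,3) by (simp add: sum_subtractf flip: sum_distrib_right of_nat_sum)
  finally show ?thesis by simp
qed

section \<open>Type classes of words\<close>

text \<open>Words are represented as in product measures, that is, \<open>undefined\<close> outside \<open>{..<N}\<close>.\<close>

definition word_type :: "nat \<Rightarrow> (nat \<Rightarrow> 'z) \<Rightarrow> 'z multiset" where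
  "word_type N \<omega> = mset (map \<omega> [0..<N])"

definition words_of_type :: "nat \<Rightarrow> 'z multiset \<Rightarrow> (nat \<Rightarrow> 'z) set" where
  "words_of_type N T = {\<omega> \<in> extensional {..<N}. word_type N \<omega> = T}"

lemma size_word_type [simp]: "size (word_type N \<omega>) = N"
  by (simp add: word_type_def)

lemma set_mset_word_type: "set_mset (word_type N \<omega>) = \<omega> ` {..<N}"
  by (simp add: word_type_def atLeast0LessThan)

lemma set_mset_word_type_subset: "\<omega> \<in> {..<N} \<rightarrow>\<^sub>E S \<Longrightarrow> set_mset (word_type N \<omega>) \<subseteq> S"
  by (auto simp: set_mset_word_type)

lemma words_of_type_subset_PiE: "set_mset T \<subseteq> S \<Longrightarrow> words_of_type N T \<subseteq> {..<N} \<rightarrow>\<^sub>E S"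
  by (auto simp: words_of_type_def PiE_def set_mset_word_type)

text \<open>A word is \<open>undefined\<close> outside \<open>{..<N}\<close>, so its first
  \<open>N\<close> values determine it. The bijection transfers the count of the arrangements of a
  multiset to type classes.\<close>

lemma bij_betw_words_of_type:
  assumes "size T = N"
  shows "bij_betw (\<lambda>\<omega>. map \<omega> [0..<N]) (words_of_type N T) (permutations_of_multiset T)"
proof (rule bij_betw_byWitness[where f' = "\<lambda>xs. \<lambda>i\<in>{..<N}. xs ! i"])
  show "\<forall>\<omega>\<in>words_of_type N T. (\<lambda>i\<in>{..<N}. map \<omega> [0..<N] ! i) = \<omega>"
    by (auto simp: words_of_type_def extensional_def)
  have len: "length xs = N" if "xs \<in> permutations_of_multiset T" for xs
    using permutations_of_multisetD[OF that] assms by auto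
  have *: "map (\<lambda>i\<in>{..<N}. xs ! i) [0..<N] = xs" if "xs \<in> permutations_of_multiset T" for xs
    using len[OF that] by (intro nth_equalityI) auto
  then show "\<forall>xs\<in>permutations_of_multiset T. map (\<lambda>i\<in>{..<N}. xs ! i) [0..<N] = xs"
    by blast
  show "(\<lambda>\<omega>. map \<omega> [0..<N]) ` words_of_type N T \<subseteq> permutations_of_multiset T"
    by (auto simp: words_of_type_def word_type_def intro!: permutations_of_multisetI)
  show "(\<lambda>xs. \<lambda>i\<in>{..<N}. xs ! i) ` permutations_of_multiset T \<subseteq> words_of_type N T"
    using * permutations_of_multisetD by (fastforce simp: words_of_type_def word_type_def simp del: mset_map)
qed

lemma sum_count_superset:
  assumes "finite S" "set_mset T \<subseteq> S"
  shows "(\<Sum>z\<in>S. count T z) = size T"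
  using sum.mono_neutral_left[OF assms, of "count T"]
  by (simp add: size_multiset_overloaded_eq not_in_iff)

text \<open>The multinomial coefficient, in product form to avoid division. Letters of
  \<open>S\<close> outside \<open>T\<close> contribute \<open>0! = 1\<close>.\<close>

lemma card_words_of_type:
  assumes "finite S" "set_mset T \<subseteq> S" "size T = N"
  shows "real (card (words_of_type N T)) * (\<Prod>z\<in>S. fact (count T z)) = fact N"
proof -
  have "card (words_of_type N T) * (\<Prod>z\<in>S. fact (count T z)) = fact N"
    using card_permutations_of_multiset_aux[of T] bij_betw_same_card[OF bij_betw_words_of_type[OF assms(3)]]
      prod.mono_neutral_left[OF assms(1,2), of "\<lambda>z. fact (count T z) :: nat"] assms(3)
    by (simp add: not_in_iff)
  from arg_cong[OF this, of real] show ?thesis by simp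
qed

text \<open>Equal letters are grouped. With \<open>f\<close> the point masses of \<open>Q\<close>,
  this shows that the mass of a word under the power of \<open>Q\<close> depends only on its
  type.\<close>

lemma prod_over_word:
  assumes "finite S" "set_mset T \<subseteq> S" "\<omega> \<in> words_of_type N T"
  shows "(\<Prod>i<N. f (\<omega> i)) = (\<Prod>z\<in>S. f z ^ count T z)"
proof -
  have "(\<Prod>i<N. f (\<omega> i)) = prod_mset (image_mset f (word_type N \<omega>))"
    by (simp add: word_type_def prod_unfold_prod_mset atLeast0LessThan multiset.map_comp comp_def)
  also have "\<dots> = prod_mset (image_mset f T)"
    using assms(3) by (simp add: words_of_type_def)
  also have "\<dots> = (\<Prod>z\<in>set_mset T. f z ^ count T z)"
    by (rule image_prod_mset_multiplicity)
  also have "\<dots> = (\<Prod>z\<in>S. f z ^ count T z)"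
    using assms(1,2) by (intro prod.mono_neutral_left) (auto simp: not_in_iff)
  finally show ?thesis .
qed

lemma words_of_type_permutation:
  assumes "\<omega> \<in> words_of_type N T" "\<omega>' \<in> words_of_type N T"
  obtains p where "p permutes {..<N}" "\<omega>' = \<omega> \<circ> p"
proof -
  have "mset (map \<omega>' [0..<N]) = mset (map \<omega> [0..<N])"
    using assms by (simp add: words_of_type_def word_type_def)
  from mset_eq_permutation[OF this] obtain p where
    p: "p permutes {..<N}" "permute_list p (map \<omega> [0..<N]) = map \<omega>' [0..<N]"
    by auto
  have "\<omega>' i = \<omega> (p i)" for i
  proof (cases "i < N")
    case True
    then have "p i < N"
      using permutes_in_image[OF p(1), of i] by simp
    then show ?thesis
      using arg_cong[OF p(2), of "\<lambda>xs. xs ! i"] True p(1) by (simp add: permute_list_nth)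
  next
    case False
    \<comment> \<open>Outside \<open>{..<N}\<close> both words are \<open>undefined\<close>, and
      \<open>p\<close> fixes \<open>i\<close>.\<close>
    then show ?thesis
      using assms permutes_not_in[OF p(1), of i] by (simp add: words_of_type_def extensional_def)
  qed
  then show thesis using that p(1) by (metis comp_apply ext)
qed

lemma word_comp_transpose:
  assumes "\<omega> \<in> extensional {..<N}" "i < N" "j < N"
  shows "\<omega> \<circ> Transposition.transpose i j \<in> extensional {..<N}"
    "word_type N (\<omega> \<circ> Transposition.transpose i j) = word_type N \<omega>"
proof -
  have p: "Transposition.transpose i j permutes {..<N}"
    using assms by (intro permutes_swap_id) auto
  show "\<omega> \<circ> Transposition.transpose i j \<in> extensional {..<N}"
    using assms(1) permutes_not_in[OF p] by (simp add: extensional_def)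
  have "permute_list (Transposition.transpose i j) (map \<omega> [0..<N])
      = map (\<omega> \<circ> Transposition.transpose i j) [0..<N]"
    using p permutes_in_image[OF p] by (intro nth_equalityI) (simp_all add: permute_list_nth)
  moreover have "mset (permute_list (Transposition.transpose i j) (map \<omega> [0..<N])) = mset (map \<omega> [0..<N])"
    using p by (intro mset_permute_list) simp
  ultimately show "word_type N (\<omega> \<circ> Transposition.transpose i j) = word_type N \<omega>"
    unfolding word_type_def by simp
qed


text \<open>The left side, number of words times mass of each, is the mass of the class under the
  power of the empirical distribution. Inserting the multinomial coefficient turns it into
  \<open>1 / C\<^sub>T\<close>.\<close>

lemma prob_words_of_type_empirical:
  assumes "finite S" "set_mset T \<subseteq> S" "size T = N"
  shows "real (card (words_of_type N T)) * (\<Prod>z\<in>S. (real (count T z) / real N) ^ count T z)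
    = 1 / (real N ^ N / fact N * (\<Prod>z\<in>S. self_power_ratio (count T z)))"
proof -
  have "(\<Sum>z\<in>S. count T z) = N"
    using sum_count_superset[OF assms(1,2)] assms(3) by simp
  then have "(\<Prod>z\<in>S. (real (count T z) / real N) ^ count T z)
      = (\<Prod>z\<in>S. real (count T z) ^ count T z) / real N ^ N"
    by (simp add: power_divide prod_dividef flip: power_sum)
  moreover have "(\<Prod>z\<in>S. self_power_ratio (count T z))
      = (\<Prod>z\<in>S. fact (count T z)) / (\<Prod>z\<in>S. real (count T z) ^ count T z)"
    by (simp add: self_power_ratio_def prod_dividef)
  moreover have "(\<Prod>z\<in>S. fact (count T z) :: real) \<noteq> 0"
    using assms(1) by simp
  ultimately show ?thesis
    by (simp add: card_words_of_type[OF assms, symmetric] field_simps)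
qed

section \<open>Measures on words over a finite alphabet\<close>

text \<open>On \<open>A\<close> the function \<open>F\<close> is a finite combination of indicators
  of points, to which linearity applies.\<close>

lemma integral_finite_space:
  fixes F :: "'a \<Rightarrow> real"
  assumes "finite_measure M" "finite A" "sets M = Pow A"
  shows "(\<integral>x. F x \<partial>M) = (\<Sum>x\<in>A. F x * measure M {x})"
proof -
  interpret finite_measure M by fact
  have sp: "space M = A"
    using assms(3) sets_eq_imp_space_eq[of M "count_space A"] by simp
  have ind: "integrable M (indicator {a} :: 'a \<Rightarrow> real)" if "a \<in> A" for a
    using that assms(3) by (intro integrable_real_indicator) (auto simp: emeasure_eq_measure)
  have "(\<integral>x. F x \<partial>M) = (\<integral>x. (\<Sum>a\<in>A. F a * indicator {a} x) \<partial>M)"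
    using assms(2) by (intro Bochner_Integration.integral_cong)
      (auto simp: sp indicator_def if_distrib sum.delta' cong: if_cong)
  also have "\<dots> = (\<Sum>a\<in>A. F a * measure M {a})"
    using ind by (subst Bochner_Integration.integral_sum) (auto simp: sp intro!: sum.cong)
  finally show ?thesis .
qed

locale finite_discrete_space =
  fixes Z :: "'z measure"
  assumes finite_space: "finite (space Z)"
    and singleton_in_sets: "z \<in> space Z \<Longrightarrow> {z} \<in> sets Z"
begin

abbreviation words :: "nat \<Rightarrow> (nat \<Rightarrow> 'z) set" where
  "words N \<equiv> {..<N} \<rightarrow>\<^sub>E space Z"

lemma finite_words: "finite (words N)"
  by (intro finite_PiE) (auto simp: finite_space)

lemma sets_eq_Pow: "sets Z = Pow (space Z)"
proof (intro antisym subsetI)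
  fix X assume "X \<in> Pow (space Z)"
  then have "(\<Union>z\<in>X. {z}) \<in> sets Z"
    using finite_space singleton_in_sets by (intro sets.finite_UN) (auto dest: finite_subset)
  then show "X \<in> sets Z" by simp
qed (auto dest: sets.sets_into_space)

text \<open>The product sigma-algebra depends only on those of the factors, so \<open>Q\<close> may
  be replaced by the counting measure on the letters.\<close>

lemma sets_power_space:
  assumes "sets Q = sets Z"
  shows "sets (power_space Q N) = Pow (words N)"
proof -
  have "sets (power_space Q N) = sets (PiM {..<N} (\<lambda>_. count_space (space Z)))"
    unfolding power_space_def by (intro sets_PiM_cong) (auto simp: assms sets_eq_Pow)
  then show ?thesis
    by (subst (asm) count_space_PiM_finite) (auto simp: finite_space intro: countable_finite)
qed

lemma space_power_space: "space (power_space Z N) = words N"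
  by (simp add: power_space_def space_PiM)

lemma prob_algebraD:
  assumes "Q \<in> space (prob_algebra Z)"
  shows "prob_space Q" "sets Q = sets Z"
  using assms by (simp_all add: space_prob_algebra)

lemma prob_space_power_space:
  assumes "Q \<in> space (prob_algebra Z)"
  shows "prob_space (power_space Q N)"
  unfolding power_space_def by (intro prob_space_PiM prob_algebraD[OF assms])

lemma measure_power_space_singleton:
  assumes Q: "Q \<in> space (prob_algebra Z)" and \<omega>: "\<omega> \<in> words N"
  shows "measure (power_space Q N) {\<omega>} = (\<Prod>i<N. measure Q {\<omega> i})"
proof -
  interpret Q: prob_space Q by (rule prob_algebraD[OF Q])
  interpret finite_product_prob_space "\<lambda>_. Q" "{..<N}"
    by unfold_locales simp
  \<comment> \<open>A single word is a box with one-point sides, whose mass the product measure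
    gives as a product.\<close>
  have "{\<omega>} = (\<Pi>\<^sub>E i\<in>{..<N}. {\<omega> i})"
    using \<omega> by (intro PiE_singleton[symmetric]) (auto simp: PiE_def)
  then show ?thesis
    unfolding power_space_def using PiE_mem[OF \<omega>] prob_algebraD(2)[OF Q] singleton_in_sets
    by (subst \<open>{\<omega>} = _\<close>, intro prob_times) auto
qed

lemma integral_power_space:
  fixes F :: "(nat \<Rightarrow> 'z) \<Rightarrow> real"
  assumes "Q \<in> space (prob_algebra Z)"
  shows "(\<integral>\<omega>. F \<omega> \<partial>(power_space Q N)) = (\<Sum>\<omega>\<in>words N. F \<omega> * measure (power_space Q N) {\<omega>})"
  using prob_space_power_space[OF assms] sets_power_space[OF prob_algebraD(2)[OF assms]]
  by (intro integral_finite_space finite_words) (auto simp: prob_space_def)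

lemma sum_singletons:
  assumes "Q \<in> space (prob_algebra Z)"
  shows "(\<Sum>z\<in>space Z. measure Q {z}) = 1"
proof -
  interpret prob_space Q by (rule prob_algebraD[OF assms])
  have "space Q = space Z"
    by (rule sets_eq_imp_space_eq[OF prob_algebraD(2)[OF assms]])
  then show ?thesis
    using finite_measure_eq_sum_singleton[OF finite_space] prob_space prob_algebraD(2)[OF assms]
      singleton_in_sets by simp
qed

lemma measure_power_space_word_of_type:
  assumes "Q \<in> space (prob_algebra Z)" "set_mset T \<subseteq> space Z" "\<omega> \<in> words_of_type N T"
  shows "measure (power_space Q N) {\<omega>} = (\<Prod>z\<in>space Z. measure Q {z} ^ count T z)"
  using assms words_of_type_subset_PiE[of T "space Z" N] finite_space
  by (subst measure_power_space_singleton) (auto intro: prod_over_word)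

lemma measure_power_space_words_of_type:
  assumes Q: "Q \<in> space (prob_algebra Z)" and T: "set_mset T \<subseteq> space Z"
  shows "measure (power_space Q N) (words_of_type N T)
    = real (card (words_of_type N T)) * (\<Prod>z\<in>space Z. measure Q {z} ^ count T z)"
proof -
  interpret prob_space "power_space Q N" by (rule prob_space_power_space[OF Q])
  have sub: "words_of_type N T \<subseteq> words N"
    using T by (rule words_of_type_subset_PiE)
  then have "measure (power_space Q N) (words_of_type N T)
      = (\<Sum>\<omega>\<in>words_of_type N T. measure (power_space Q N) {\<omega>})"
    using sets_power_space[OF prob_algebraD(2)[OF Q]] finite_words
    by (intro finite_measure_eq_sum_singleton) (auto intro: finite_subset)
  then show ?thesis
    using measure_power_space_word_of_type[OF Q T] by simp
qed

text \<open>Point masses are at most 1, so the sum of the absolute values of \<open>F\<close> over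
  all words is a common bound. Only with such a bound is a real supremum known to dominate its
  members.\<close>

lemma bdd_above_integrals:
  fixes F :: "(nat \<Rightarrow> 'z) \<Rightarrow> real"
  shows
  "bdd_above ((\<lambda>Q. \<integral>\<omega>. F \<omega> \<partial>(power_space Q N)) ` space (prob_algebra Z))"
proof (intro bdd_aboveI2)
  fix Q assume Q: "Q \<in> space (prob_algebra Z)"
  interpret prob_space "power_space Q N" by (rule prob_space_power_space[OF Q])
  have "(\<Sum>\<omega>\<in>words N. F \<omega> * measure (power_space Q N) {\<omega>}) \<le> (\<Sum>\<omega>\<in>words N. \<bar>F \<omega>\<bar>)"
  proof (intro sum_mono)
    fix \<omega>
    have "F \<omega> * prob {\<omega>} \<le> \<bar>F \<omega>\<bar> * 1"
      by (intro mult_mono) auto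
    then show "F \<omega> * prob {\<omega>} \<le> \<bar>F \<omega>\<bar>" by simp
  qed
  then show "(\<integral>\<omega>. F \<omega> \<partial>(power_space Q N)) \<le> (\<Sum>\<omega>\<in>words N. \<bar>F \<omega>\<bar>)"
    using integral_power_space[OF Q] by simp
qed

section \<open>Empirical distributions\<close>

text \<open>For empty \<open>T\<close> the default \<open>x / 0 = 0\<close> yields the zero measure,
  hence the hypothesis \<open>T \<noteq> {#}\<close> below.\<close>

definition empirical :: "'z multiset \<Rightarrow> 'z measure" where
  "empirical T = point_measure (space Z) (\<lambda>z. ennreal (real (count T z) / real (size T)))"

lemma empirical_in_prob_algebra:
  assumes "set_mset T \<subseteq> space Z" "T \<noteq> {#}"
  shows "empirical T \<in> space (prob_algebra Z)"
proof -
  have "(\<Sum>z\<in>space Z. count T z) = size T"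
    by (rule sum_count_superset[OF finite_space assms(1)])
  then have "(\<Sum>z\<in>space Z. real (count T z) / real (size T)) = 1"
    using assms(2) by (simp flip: sum_divide_distrib of_nat_sum)
  then have "prob_space (empirical T)"
    unfolding empirical_def using finite_space
    by (intro prob_space_point_measure) (auto simp: sum_ennreal)
  then show ?thesis
    by (simp add: space_prob_algebra empirical_def sets_point_measure sets_eq_Pow)
qed

lemma measure_empirical:
  "z \<in> space Z \<Longrightarrow> measure (empirical T) {z} = real (count T z) / real (size T)"
  unfolding empirical_def using finite_space by (simp add: measure_point_measure_finite_if)

section \<open>Exchangeable measures on type classes\<close>

lemma exchangeableD:
  assumes "exchangeable Z N R"
  shows "prob_space R" "sets R = Pow (words N)"
    "i < N \<Longrightarrow> j < N \<Longrightarrow> distr R (power_space Z N) (\<lambda>\<omega>. \<omega> \<circ> Transposition.transpose i j) = R"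
  using assms sets_power_space[of Z N]
  by (auto simp: exchangeable_def space_prob_algebra)

lemma vimage_transpose_singleton:
  assumes "\<omega> \<in> words N" "i < N" "j < N"
  shows "(\<lambda>\<omega>. \<omega> \<circ> Transposition.transpose i j) -` {\<omega>} \<inter> words N
    = {\<omega> \<circ> Transposition.transpose i j}"
proof -
  have "\<omega> \<circ> Transposition.transpose i j \<in> words N"
    using word_comp_transpose(1)[of \<omega> N i j] assms
    by (auto simp: PiE_def Pi_def Transposition.transpose_def)
  moreover have "\<omega>' = \<omega>' \<circ> Transposition.transpose i j \<circ> Transposition.transpose i j"
    for \<omega>' :: "nat \<Rightarrow> 'z"
    by (simp add: comp_assoc)
  ultimately show ?thesis by auto
qed

lemma transpose_measurable:
  assumes "sets R = Pow (words N)" "i < N" "j < N"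
  shows "(\<lambda>\<omega>. \<omega> \<circ> Transposition.transpose i j) \<in> measurable R (power_space Z N)"
proof (rule measurableI)
  have sp: "space R = words N"
    using assms(1) sets_eq_imp_space_eq[of R "count_space (words N)"] by simp
  then show "\<omega> \<circ> Transposition.transpose i j \<in> space (power_space Z N)" if "\<omega> \<in> space R" for \<omega>
    using word_comp_transpose(1)[of \<omega> N i j] assms(2,3) that
    by (auto simp: space_power_space PiE_def Pi_def Transposition.transpose_def)
qed (auto simp: assms(1) sets_eq_imp_space_eq[of R "count_space (words N)"])

text \<open>A transposition is an involution, so the preimage of a word is a single word. Invariance
  under swaps thus becomes an equality of point masses.\<close>

lemma emeasure_distr_transpose_singleton:
  assumes "sets R = Pow (words N)" "i < N" "j < N" "\<omega> \<in> words N"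
  shows "emeasure (distr R (power_space Z N) (\<lambda>\<omega>. \<omega> \<circ> Transposition.transpose i j)) {\<omega>}
    = emeasure R {\<omega> \<circ> Transposition.transpose i j}"
proof -
  have "space R = words N"
    using assms(1) sets_eq_imp_space_eq[of R "count_space (words N)"] by simp
  then show ?thesis
    using assms transpose_measurable[OF assms(1-3)] sets_power_space[of Z N]
    by (subst emeasure_distr) (auto simp: vimage_transpose_singleton simp del: vimage_singleton_eq)
qed

text \<open>Two words of one type differ by a permutation of the positions, which is a product of
  transpositions. The induction appends transpositions on the right, where each acts as a swap on
  the word \<open>\<omega> \<circ> p\<close> reached so far.\<close>

lemma exchangeable_singleton_eq:
  assumes R: "exchangeable Z N R" and T: "set_mset T \<subseteq> space Z"
    and \<omega>: "\<omega> \<in> words_of_type N T" "\<omega>' \<in> words_of_type N T"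
  shows "measure R {\<omega>} = measure R {\<omega>'}"
proof -
  obtain p where p: "p permutes {..<N}" "\<omega>' = \<omega> \<circ> p"
    using \<omega> by (rule words_of_type_permutation)
  have "\<omega> \<circ> p \<in> words_of_type N T \<and> measure R {\<omega> \<circ> p} = measure R {\<omega>}"
    using finite_lessThan p(1)
  proof (induction p rule: permutes_rev_induct)
    case (swap i j p)
    then have ij: "i < N" "j < N"
      by simp_all
    from swap.IH have IH: "\<omega> \<circ> p \<in> words_of_type N T" "measure R {\<omega> \<circ> p} = measure R {\<omega>}"
      by blast+
    have "\<omega> \<circ> p \<circ> Transposition.transpose i j \<in> words_of_type N T"
      using word_comp_transpose[OF _ ij, of "\<omega> \<circ> p"] IH(1) unfolding words_of_type_def by blast
    moreover have "\<omega> \<circ> p \<in> words N"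
      using IH(1) words_of_type_subset_PiE[OF T] by blast
    then have "measure R {\<omega> \<circ> p \<circ> Transposition.transpose i j} = measure R {\<omega> \<circ> p}"
      using emeasure_distr_transpose_singleton[OF exchangeableD(2)[OF R] ij, of "\<omega> \<circ> p"]
        exchangeableD(3)[OF R ij] by (simp add: measure_def)
    ultimately show ?case
      using IH(2) by (simp only: comp_assoc)
  qed (use \<omega> in simp)
  then show ?thesis using p(2) by simp
qed

section \<open>Uniform measures on type classes\<close>

definition uniform_on_type :: "nat \<Rightarrow> 'z multiset \<Rightarrow> (nat \<Rightarrow> 'z) measure" where
  "uniform_on_type N T = point_measure (words N)
     (\<lambda>\<omega>. ennreal (indicator (words_of_type N T) \<omega> / real (card (words_of_type N T))))"

lemma words_of_type_nonempty:
  "size T = N \<Longrightarrow> words_of_type N T \<noteq> {}"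
  using bij_betw_words_of_type[of T N] permutations_of_multiset_not_empty[of T]
  by (metis bij_betw_empty1)

text \<open>A swap of coordinates preserves types and therefore the density; on a finite discrete
  space it suffices to compare point masses.\<close>

lemma
  assumes T: "set_mset T \<subseteq> space Z" "size T = N"
  shows exchangeable_uniform_on_type: "exchangeable Z N (uniform_on_type N T)"
    and measure_uniform_on_type: "measure (uniform_on_type N T) (words_of_type N T) = 1"
proof -
  let ?W = "words_of_type N T" and ?R = "uniform_on_type N T"
  have sub: "?W \<subseteq> words N"
    using T(1) by (rule words_of_type_subset_PiE)
  \<comment> \<open>The class is nonempty, so the normalising divisor of the density is not
    0.\<close>
  then have card: "card ?W > 0"
    using words_of_type_nonempty[OF T(2)] finite_words by (auto simp: card_gt_0_iff intro: finite_subset)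
  have sum: "(\<Sum>\<omega>\<in>words N. indicator ?W \<omega> / real (card ?W)) = 1"
    using card sub finite_words
    by (simp add: indicator_def sum.If_cases Int_absorb1 flip: sum_divide_distrib)
  have prob: "prob_space ?R"
    unfolding uniform_on_type_def using sum finite_words
    by (intro prob_space_point_measure) (auto simp: sum_ennreal)
  have sets: "sets ?R = Pow (words N)"
    by (simp add: uniform_on_type_def sets_point_measure)
  show "measure ?R ?W = 1"
    unfolding uniform_on_type_def using card sub finite_words
    by (subst measure_point_measure_finite_if) simp_all
  have "distr ?R (power_space Z N) (\<lambda>\<omega>. \<omega> \<circ> Transposition.transpose i j) = ?R"
    if ij: "i < N" "j < N" for i j
  proof (rule measure_eqI_finite[OF _ sets finite_words])
    fix \<omega> assume \<omega>: "\<omega> \<in> words N"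
    have "\<omega> \<circ> Transposition.transpose i j \<in> words N"
      using vimage_transpose_singleton[OF \<omega> ij] by blast
    moreover have "\<omega> \<circ> Transposition.transpose i j \<in> ?W \<longleftrightarrow> \<omega> \<in> ?W"
      using word_comp_transpose[of \<omega> N i j] \<omega> ij by (auto simp: words_of_type_def PiE_def)
    ultimately have "emeasure ?R {\<omega> \<circ> Transposition.transpose i j} = emeasure ?R {\<omega>}"
      unfolding uniform_on_type_def using \<omega> finite_words
      by (simp add: emeasure_point_measure_finite indicator_def)
    then show "emeasure (distr ?R (power_space Z N) (\<lambda>\<omega>. \<omega> \<circ> Transposition.transpose i j)) {\<omega>}
        = emeasure ?R {\<omega>}"
      using emeasure_distr_transpose_singleton[OF sets ij \<omega>] by simp
  qed (simp add: sets_power_space)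
  then show "exchangeable Z N ?R"
    using prob sets sets_power_space[of Z N] by (simp add: exchangeable_def space_prob_algebra)
qed

section \<open>Comparison of the two expectations\<close>

text \<open>The empirical distribution of \<open>T\<close> is one candidate in the supremum.
  Dropping the nonnegative terms outside the class leaves the left side.\<close>

lemma empirical_sum_le_rand_expectation:
  assumes F: "\<And>\<omega>. \<omega> \<in> words N \<Longrightarrow> 0 \<le> F \<omega>"
    and T: "set_mset T \<subseteq> space Z" "size T = N" and "N > 0"
  shows "(\<Sum>\<omega>\<in>words_of_type N T. F \<omega>) * (\<Prod>z\<in>space Z. (real (count T z) / real N) ^ count T z)
    \<le> rand_expectation Z N F"
proof -
  have Q: "empirical T \<in> space (prob_algebra Z)"
    using T \<open>N > 0\<close> by (intro empirical_in_prob_algebra) auto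
  have sub: "words_of_type N T \<subseteq> words N"
    using T(1) by (rule words_of_type_subset_PiE)
  have "(\<Sum>\<omega>\<in>words_of_type N T. F \<omega>) * (\<Prod>z\<in>space Z. (real (count T z) / real N) ^ count T z)
      = (\<Sum>\<omega>\<in>words_of_type N T. F \<omega> * measure (power_space (empirical T) N) {\<omega>})"
    using measure_power_space_word_of_type[OF Q T(1)]
    by (simp add: measure_empirical T(2) sum_distrib_right)
  also have "\<dots> \<le> (\<Sum>\<omega>\<in>words N. F \<omega> * measure (power_space (empirical T) N) {\<omega>})"
    using sub F by (intro sum_mono2 finite_words) auto
  also have "\<dots> = (\<integral>\<omega>. F \<omega> \<partial>(power_space (empirical T) N))"
    using integral_power_space[OF Q] by simp
  also have "\<dots> \<le> rand_expectation Z N F"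
    unfolding rand_expectation_def by (rule cSUP_upper[OF Q bdd_above_integrals])
  finally show ?thesis .
qed

text \<open>On each type class \<open>R\<close> has constant point mass, so \<open>F\<close> may be
  replaced there by the constant \<open>C * rand_expectation Z N F\<close> at no loss. Summing over
  the classes uses that \<open>R\<close> has total mass 1.\<close>

lemma exchangeable_integral_le:
  assumes R: "exchangeable Z N R" and F: "\<And>\<omega>. \<omega> \<in> words N \<Longrightarrow> 0 \<le> F \<omega>" and "N > 0"
    and C: "\<And>T. set_mset T \<subseteq> space Z \<Longrightarrow> size T = N \<Longrightarrow>
      real N ^ N / fact N * (\<Prod>z\<in>space Z. self_power_ratio (count T z)) \<le> C"
  shows "(\<integral>\<omega>. F \<omega> \<partial>R) \<le> C * rand_expectation Z N F"
proof -
  interpret prob_space R by (rule exchangeableD(1)[OF R])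
  let ?E = "rand_expectation Z N F"
  define types where "types = word_type N ` words N"
  have group: "(\<Sum>T\<in>types. \<Sum>\<omega>\<in>words_of_type N T. f \<omega>) = (\<Sum>\<omega>\<in>words N. f \<omega>)"
    for f :: "_ \<Rightarrow> real"
  proof -
    have eq: "words_of_type N T = {\<omega>. \<omega> \<in> words N \<and> word_type N \<omega> = T}" if "T \<in> types" for T
    proof -
      have "set_mset T \<subseteq> space Z"
        using that set_mset_word_type_subset[of _ N "space Z"] unfolding types_def by blast
      from words_of_type_subset_PiE[OF this, of N] show ?thesis
        unfolding words_of_type_def PiE_def by blast
    qed
    have "(\<Sum>T\<in>types. \<Sum>\<omega>\<in>words_of_type N T. f \<omega>)
        = (\<Sum>T\<in>types. \<Sum>\<omega>\<in>{\<omega>. \<omega> \<in> words N \<and> word_type N \<omega> = T}. f \<omega>)"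
      by (intro sum.cong refl eq)
    also have "\<dots> = (\<Sum>\<omega>\<in>words N. f \<omega>)"
      unfolding types_def by (intro sum.group finite_imageI finite_words subset_refl)
    finally show ?thesis .
  qed
  have "(\<integral>\<omega>. F \<omega> \<partial>R) = (\<Sum>\<omega>\<in>words N. F \<omega> * prob {\<omega>})"
    by (rule integral_finite_space[OF finite_measure_axioms finite_words exchangeableD(2)[OF R]])
  also have "\<dots> = (\<Sum>T\<in>types. \<Sum>\<omega>\<in>words_of_type N T. F \<omega> * prob {\<omega>})"
    by (rule group[symmetric])
  also have "\<dots> \<le> (\<Sum>T\<in>types. \<Sum>\<omega>\<in>words_of_type N T. C * ?E * prob {\<omega>})"
  proof (rule sum_mono)
    fix T assume "T \<in> types"
    then obtain \<omega>0 where \<omega>0: "\<omega>0 \<in> words N" "T = word_type N \<omega>0"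
      unfolding types_def by blast
    then have T: "set_mset T \<subseteq> space Z" "size T = N"
      using set_mset_word_type_subset[OF \<omega>0(1)] by simp_all
    let ?W = "words_of_type N T"
    let ?p = "\<Prod>z\<in>space Z. (real (count T z) / real N) ^ count T z"
    let ?c = "real N ^ N / fact N * (\<Prod>z\<in>space Z. self_power_ratio (count T z))"
    have const: "prob {\<omega>} = prob {\<omega>0}" if "\<omega> \<in> ?W" for \<omega>
    proof (rule exchangeable_singleton_eq[OF R T(1) that])
      show "\<omega>0 \<in> ?W"
        using \<omega>0 by (simp add: words_of_type_def PiE_def)
    qed
    have c: "?c > 0"
      using \<open>N > 0\<close> self_power_ratio_pos by (intro mult_pos_pos prod_pos divide_pos_pos) auto
    \<comment> \<open>Absent letters contribute \<open>0 ^ 0 = 1\<close>, so no factor vanishes and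
      \<open>?p\<close> can be cancelled later.\<close>
    have p: "?p > 0"
      using \<open>N > 0\<close> by (intro prod_pos) (auto simp: zero_less_power_eq intro!: Nat.gr0I)
    have cp: "real (card ?W) * ?p * ?c = 1"
    proof -
      have "1 / y * y = 1" if "y > 0" for y :: real
        using that by simp
      from this[OF c] show ?thesis
        by (simp only: prob_words_of_type_empirical[OF finite_space T])
    qed
    have E: "sum F ?W * ?p \<le> ?E"
      using empirical_sum_le_rand_expectation[OF F T \<open>N > 0\<close>] .
    have "0 \<le> sum F ?W"
      using words_of_type_subset_PiE[OF T(1)] F by (intro sum_nonneg) blast
    then have "0 \<le> sum F ?W * ?p"
      using p by simp
    then have "0 \<le> ?E"
      using E by (rule order_trans)
    \<comment> \<open>By \<open>cp\<close> and \<open>?c \<le> C\<close>, the number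
      \<open>card ?W * ?p * C\<close> is at least 1, so it may be multiplied onto the nonnegative
      bound \<open>?E\<close>.\<close>
    have "sum F ?W * ?p \<le> real (card ?W) * C * ?E * ?p"
    proof -
      have "real (card ?W) * ?p * ?c \<le> real (card ?W) * ?p * C"
        by (rule mult_left_mono[OF C[OF T]]) (use p in simp)
      then have "1 \<le> real (card ?W) * ?p * C"
        by (simp only: cp)
      from mult_right_mono[OF this \<open>0 \<le> ?E\<close>] E show ?thesis by (simp add: mult_ac)
    qed
    then have "sum F ?W \<le> real (card ?W) * C * ?E"
      using p by simp
    then have "sum F ?W * prob {\<omega>0} \<le> real (card ?W) * C * ?E * prob {\<omega>0}"
      by (intro mult_right_mono) auto
    then show "(\<Sum>\<omega>\<in>?W. F \<omega> * prob {\<omega>}) \<le> (\<Sum>\<omega>\<in>?W. C * ?E * prob {\<omega>})"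
      by (simp add: const sum_distrib_right mult_ac)
  qed
  also have "\<dots> = (\<Sum>\<omega>\<in>words N. C * ?E * prob {\<omega>})"
    by (rule group)
  also have "\<dots> = C * ?E * prob (words N)"
    using exchangeableD(2)[OF R] finite_measure_eq_sum_singleton[OF finite_words[of N]]
    by (simp add: sum_distrib_left)
  also have "prob (words N) = 1"
    using prob_space sets_eq_imp_space_eq[of R "count_space (words N)"] exchangeableD(2)[OF R] by simp
  finally show ?thesis by simp
qed

section \<open>The extremal event\<close>

text \<open>The integral of an indicator is the measure of the event; this lets the extremal event
  prove tightness for functions as well.\<close>

lemma rand_prob_eq_rand_expectation:
  assumes "A \<subseteq> words N"
  shows "rand_prob Z N A = rand_expectation Z N (indicator A)"
  unfolding rand_prob_def rand_expectation_def
proof (intro SUP_cong refl)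
  fix Q assume "Q \<in> space (prob_algebra Z)"
  then have "sets (power_space Q N) = Pow (words N)"
    by (intro sets_power_space prob_algebraD)
  then show "measure (power_space Q N) A = (\<integral>\<omega>. indicator A \<omega> \<partial>(power_space Q N))"
    using assms sets_eq_imp_space_eq[of "power_space Q N" "count_space (words N)"]
    by (simp add: Int_absorb2)
qed

lemma exch_prob_eq_exch_expectation:
  assumes "A \<subseteq> words N"
  shows "exch_prob Z N A = exch_expectation Z N (indicator A)"
  unfolding exch_prob_def exch_expectation_def
proof (intro SUP_cong refl)
  fix R assume "R \<in> {R. exchangeable Z N R}"
  then show "measure R A = (\<integral>\<omega>. indicator A \<omega> \<partial>R)"
    using assms exchangeableD(2)[of N R] sets_eq_imp_space_eq[of R "count_space (words N)"]
    by (simp add: Int_absorb2)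
qed

text \<open>The trivial bound 1 is attained by the uniform measure on the class.\<close>

lemma exch_prob_words_of_type:
  assumes T: "set_mset T \<subseteq> space Z" "size T = N"
  shows "exch_prob Z N (words_of_type N T) = 1"
  unfolding exch_prob_def
proof (rule cSup_eq_maximum)
  show "1 \<in> (\<lambda>R. measure R (words_of_type N T)) ` {R. exchangeable Z N R}"
    using exchangeable_uniform_on_type[OF T] measure_uniform_on_type[OF T] by force
  show "x \<le> 1" if "x \<in> (\<lambda>R. measure R (words_of_type N T)) ` {R. exchangeable Z N R}" for x
    using that by (auto intro!: prob_space.prob_le_1 exchangeableD)
qed

text \<open>All words of the class have the same mass under a power of \<open>Q\<close>, and by
  Gibbs' inequality the empirical distribution of \<open>T\<close> maximises it.\<close>

lemma rand_prob_words_of_type: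
  assumes T: "set_mset T \<subseteq> space Z" "size T = N" and "N > 0"
  shows "rand_prob Z N (words_of_type N T)
    = 1 / (real N ^ N / fact N * (\<Prod>z\<in>space Z. self_power_ratio (count T z)))"
  unfolding rand_prob_def prob_words_of_type_empirical[OF finite_space T, symmetric]
proof (rule cSup_eq_maximum)
  let ?M = "\<lambda>Q. measure (power_space Q N) (words_of_type N T)"
  have "empirical T \<in> space (prob_algebra Z)"
    using T \<open>N > 0\<close> by (intro empirical_in_prob_algebra) auto
  from imageI[OF this, of ?M] measure_power_space_words_of_type[OF this T(1)]
  show "real (card (words_of_type N T)) * (\<Prod>z\<in>space Z. (real (count T z) / real N) ^ count T z)
      \<in> ?M ` space (prob_algebra Z)"
    by (simp add: measure_empirical T(2))
  have "(\<Sum>z\<in>space Z. count T z) = N"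
    using sum_count_superset[OF finite_space T(1)] T(2) by simp
  then have "?M Q \<le> real (card (words_of_type N T)) * (\<Prod>z\<in>space Z. (real (count T z) / real N) ^ count T z)"
    if "Q \<in> space (prob_algebra Z)" for Q
    unfolding measure_power_space_words_of_type[OF that T(1)]
    using sum_singletons[OF that] \<open>N > 0\<close>
    by (intro mult_left_mono prod_power_le_empirical) auto
  then show "x \<le> real (card (words_of_type N T)) * (\<Prod>z\<in>space Z. (real (count T z) / real N) ^ count T z)"
    if "x \<in> ?M ` space (prob_algebra Z)" for x
    using that by blast
qed

end

theorem proposition6:
  fixes Z :: "'z measure" and N K :: nat and n :: "nat \<Rightarrow> nat" and C :: real
  assumes finite_Z: "finite (space Z)"
    and nonempty_Z: "space Z \<noteq> {}"
    and singletons: "\<And>z. z \<in> space Z \<Longrightarrow> {z} \<in> sets Z"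
    and N_pos: "N \<ge> 1"
    and K_eq: "K = card (space Z)"
    and K_le: "K \<le> N"
    and balanced: "\<And>k. k \<in> {1..K} \<Longrightarrow>
      int (n k) \<in> {\<lfloor>real N / real K\<rfloor>, \<lceil>real N / real K\<rceil>}"
    and sum_n: "(\<Sum>k=1..K. n k) = N"
    and C_eq: "C = real N ^ N / fact N * (\<Prod>k=1..K. fact (n k) / real (n k) ^ n k)"
  shows "(\<forall>F :: (nat \<Rightarrow> 'z) \<Rightarrow> real. (\<forall>\<omega>\<in>space (power_space Z N). 0 \<le> F \<omega>) \<longrightarrow>
            exch_expectation Z N F \<le> C * rand_expectation Z N F)
       \<and> (\<forall>C' :: real. C' < C \<longrightarrow>
            (\<exists>F :: (nat \<Rightarrow> 'z) \<Rightarrow> real. (\<forall>\<omega>\<in>space (power_space Z N). 0 \<le> F \<omega>) \<and>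
               \<not> exch_expectation Z N F \<le> C' * rand_expectation Z N F))
       \<and> (\<exists>A. A \<in> sets (power_space Z N) \<and>
            rand_prob Z N A = 1 / C \<and> 1 / C \<le> 1 \<and> exch_prob Z N A = 1)"
proof -
  interpret finite_discrete_space Z
    using finite_Z singletons by unfold_locales
  have N: "N > 0" using N_pos by simp
  obtain h where h: "bij_betw h (space Z) {1..K}"
    using finite_Z K_eq by (metis bij_betw_iff_card card_atLeastAtMost diff_Suc_1 finite_atLeastAtMost)
  \<comment> \<open>\<open>B\<close> is the type in which the letter numbered \<open>k\<close> by
    \<open>h\<close> occurs \<open>n k\<close> times; its constant is exactly
    \<open>C\<close>.\<close>
  define B where "B = (\<Sum>z\<in>space Z. replicate_mset (n (h z)) z)"
  have count_B: "count B z = n (h z)" if "z \<in> space Z" for z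
    using that finite_Z by (simp add: B_def count_sum sum.delta cong: if_cong)
  have B: "set_mset B \<subseteq> space Z"
    using finite_Z by (auto simp: B_def set_mset_sum split: if_splits)
  have size_B: "size B = N"
    using sum.reindex_bij_betw[OF h, of n] sum_n by (simp add: B_def size_multiset_sum)
  have C_B: "C = real N ^ N / fact N * (\<Prod>z\<in>space Z. self_power_ratio (count B z))"
    using prod.reindex_bij_betw[OF h, of "\<lambda>k. self_power_ratio (n k)"]
    by (simp add: C_eq count_B self_power_ratio_def)
  have C_max: "real N ^ N / fact N * (\<Prod>z\<in>space Z. self_power_ratio (count T z)) \<le> C"
    if T: "set_mset T \<subseteq> space Z" "size T = N" for T
    unfolding C_B
  proof (intro mult_left_mono prod_self_power_ratio_le_balanced[where m = "N div K"])
    show "count B z = N div K \<or> count B z = Suc (N div K)" if "z \<in> space Z" for z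
      using balanced_split_cases[OF balanced] bij_betwE[OF h] that by (simp add: count_B)
  qed (use finite_Z sum_count_superset[OF finite_Z] B size_B T in auto)
  have C_pos: "C > 0"
    unfolding C_B using N self_power_ratio_pos by (intro mult_pos_pos prod_pos divide_pos_pos) auto
  let ?A = "words_of_type N B"
  have A: "?A \<subseteq> words N"
    using B by (rule words_of_type_subset_PiE)
  have rand_A: "rand_prob Z N ?A = 1 / C"
    unfolding C_B by (rule rand_prob_words_of_type[OF B size_B N])
  have exch_A: "exch_prob Z N ?A = 1"
    by (rule exch_prob_words_of_type[OF B size_B])
  have upper: "exch_expectation Z N F \<le> C * rand_expectation Z N F"
    if "\<forall>\<omega>\<in>space (power_space Z N). 0 \<le> F \<omega>" for F
    unfolding exch_expectation_def
  proof (rule cSUP_least)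
    \<comment> \<open>A bound on a real supremum needs a nonempty set; the uniform measure on
      \<open>?A\<close> is a member.\<close>
    show "{R. exchangeable Z N R} \<noteq> {}"
      using exchangeable_uniform_on_type[OF B size_B] by blast
    show "(\<integral>\<omega>. F \<omega> \<partial>R) \<le> C * rand_expectation Z N F" if "R \<in> {R. exchangeable Z N R}" for R
      using that \<open>\<forall>\<omega>\<in>space (power_space Z N). 0 \<le> F \<omega>\<close> N
      by (intro exchangeable_integral_le C_max) (auto simp: space_power_space)
  qed
  moreover have "\<exists>F :: (nat \<Rightarrow> 'z) \<Rightarrow> real. (\<forall>\<omega>\<in>space (power_space Z N). 0 \<le> F \<omega>) \<and>
      \<not> exch_expectation Z N F \<le> C' * rand_expectation Z N F" if "C' < C" for C'
  proof (intro exI conjI ballI)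
    \<comment> \<open>The indicator of \<open>?A\<close> has the expectations 1 and
      \<open>1 / C\<close>, and \<open>C' / C < 1\<close> because \<open>C\<close> is
      positive.\<close>
    show "\<not> exch_expectation Z N (indicator ?A) \<le> C' * rand_expectation Z N (indicator ?A)"
      using that C_pos rand_A exch_A
      by (simp add: rand_prob_eq_rand_expectation[OF A] exch_prob_eq_exch_expectation[OF A])
  qed simp
  moreover have "1 / C \<le> 1"
  proof -
    \<comment> \<open>\<open>1 / C\<close> is a supremum of probabilities; the empirical
      distribution shows that it is taken over a nonempty set.\<close>
    have "empirical B \<in> space (prob_algebra Z)"
      using B size_B N by (intro empirical_in_prob_algebra) auto
    then have "rand_prob Z N ?A \<le> 1"
      unfolding rand_prob_def
      by (intro cSUP_least) (auto intro: prob_space.prob_le_1 prob_space_power_space)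
    then show ?thesis
      by (simp add: rand_A)
  qed
  moreover have "?A \<in> sets (power_space Z N)"
    using A by (simp add: sets_power_space)
  ultimately show ?thesis
    using rand_A exch_A by blast
qed

end
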